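(* If there exists a regular KKT point $(\bar z,\bar\lambda)$, then there exists $\bar\xi>1/\lambda^+_{\min}(R)$ such that for every $\xi\ge\bar\xi$ the operator $T_\xi$ has at least one fixed point, i.e. there is $s\in\mathbb R^n$ with $s\in T_\xi(s)$; equivalently, for every $\xi\ge\bar\xi$ the iteration $$z_{j+1}=M_\xi s_j+c_\xi,\qquad y_{j+1}\in\Pi_{\mathcal Z}(s_j),\qquad s_{j+1}=s_j-\gamma W(z_{j+1}-y_{j+1})\qquad(\gamma\in(0,1))$$ has at least one fixed point, i.e. a triple $(z,y,s)$ with $z=M_\xi s+c_\xi$, $y\in\Pi_{\mathcal Z}(s)$ and $s=s-\gamma W(z-y)$.
   Context: Setting: $H\in\mathbb R^{n\times n}$ is (symmetric) positive definite, $h\in\mathbb R^n$. The set $\mathcal Z=\prod_{k=1}^N\big(\bigcup_{i=1}^{m_k}\mathcal Z_{k,i}\big)\subseteq\mathbb R^n$, where $n=\sum_k n_k$ and each $\mathcal Z_{k,i}\subseteq\mathbb R^{n_k}$ is a closed convex polyhedron. The set $\mathcal E=\{z\in\mathbb R^n: Az=b\}=\{Vv+\bar v: v\in\mathbb R^{n-m}\}$, with $A\in\mathbb R^{m\times n}$ of full row rank, $V\in\mathbb R^{n\times(n-m)}$ of full column rank, $\bar v\in\mathbb R^n$. It is assumed that $\mathcal E\cap\mathcal Z\neq\varnothing$. The underlying problem is $\min_{z\in\mathcal E\cap\mathcal Z}\tfrac12z^\top Hz+h^\top z$. Projection: $\Pi_{\mathcal Z}(s)=\operatorname{argmin}_{z\in\mathcal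 Z}\|s-z\|$ (set-valued). Regular normal cone of a closed set $\mathcal C$ at $z\in\mathcal C$: $\hat N_{\mathcal C}(z)=\{x:\limsup_{u\to z,\,u\in\mathcal C,\,u\ne z}\langle x,u-z\rangle/\|u-z\|\le0\}$ (empty if $z\notin\mathcal C$). Regular KKT point: a pair $(z,\lambda)\in\mathbb R^n\times\mathbb R^n$ with $0\in\{Hz+h\}+\hat N_{\mathcal E}(z)-\{\lambda\}$ and $0\in\hat N_{\mathcal Z}(z)+\{\lambda\}$. Matrices: $R=V(V^\top HV)^{-1}V^\top$; $\lambda^+_{\min}(R)$ is its smallest non-zero eigenvalue; $M_\xi=\xi(\xi R-I)^{-1}R$; $c_\xi=(\xi R-I)^{-1}(R(h+H\bar v)-\bar v)$. For $\xi>1/\lambda^+_{\min}(R)$ the matrix $M_\xi$ is well defined, symmetric positive semidefinite with $n-m$ positive eigenvalues; write $M_\xi=Q\,\mathrm{diag}(\Lambda,0)\,Q^\top$ with $Q$ orthonormal and $\Lambda\in\mathbb R^{(n-m)\times(n-m)}$ diagonal positive definite, and set $W=Q\,\mathrm{diag}(\tfrac12\Lambda^{-1},-I)\,Q^\top$. Operator: $T_\xi(s)=\{s-W(M_\xi s+c_\xi-y): y\in\Pi_{\mathcal Z}(s)\}$. *)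

theory Defs
  imports "HOL-Analysis.Analysis"
begin

definition pos_def_matrix :: "real^'n^'n \<Rightarrow> bool" where
  "pos_def_matrix H \<longleftrightarrow> transpose H = H \<and> (\<forall>x. x \<noteq> 0 \<longrightarrow> x \<bullet> (H *v x) > 0)"

definition diag_matrix :: "('n \<Rightarrow> real) \<Rightarrow> real^'n^'n" where
  "diag_matrix d = (\<chi> i j. if i = j then d i else 0)"

text \<open>
  The factor space \<open>\<real>\<^bsup>n\<^sub>k\<^esup>\<close> of the product is encoded as a coordinate subspace of \<open>real^'n\<close>:
  a map \<open>blk\<close> assigns to each of the \<open>n\<close> coordinates the number of its block, so that \<open>n\<^sub>k\<close> is the
  number of coordinates \<open>j\<close> with \<open>blk j = k\<close>. A subset of this subspace is a polyhedron in
  \<open>\<real>\<^bsup>n\<^sub>k\<^esup>\<close> iff it is a polyhedron in \<open>real^'n\<close>.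
\<close>

definition block_space :: "('n \<Rightarrow> nat) \<Rightarrow> nat \<Rightarrow> (real^'n) set" where
  "block_space blk k = {x. \<forall>j. blk j \<noteq> k \<longrightarrow> x $ j = 0}"

definition block_part :: "('n \<Rightarrow> nat) \<Rightarrow> nat \<Rightarrow> real^'n \<Rightarrow> real^'n" where
  "block_part blk k z = (\<chi> j. if blk j = k then z $ j else 0)"

definition union_product ::
  "('n \<Rightarrow> nat) \<Rightarrow> nat \<Rightarrow> (nat \<Rightarrow> nat) \<Rightarrow> (nat \<Rightarrow> nat \<Rightarrow> (real^'n) set) \<Rightarrow> (real^'n) set" where
  "union_product blk N m P = {z. \<forall>k\<in>{1..N}. block_part blk k z \<in> (\<Union>i\<in>{1..m k}. P k i)}"

definition proj_set :: "'a::real_normed_vector set \<Rightarrow> 'a \<Rightarrow> 'a set" where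
  "proj_set Z s = {z. is_arg_min (\<lambda>z. norm (s - z)) (\<lambda>z. z \<in> Z) z}"

text \<open>
  The filter \<open>at z within C\<close> excludes \<open>z\<close> itself. If \<open>z\<close> is isolated in \<open>C\<close>, the filter is trivial,
  the \<open>Limsup\<close> is \<open>-\<infinity>\<close>, and the cone is the whole space.
\<close>

definition regular_normal_cone :: "'a::real_inner set \<Rightarrow> 'a \<Rightarrow> 'a set" where
  "regular_normal_cone C z =
     {x. z \<in> C \<and> Limsup (at z within C) (\<lambda>u. ereal ((x \<bullet> (u - z)) / norm (u - z))) \<le> 0}"

definition regular_KKT_point ::
  "real^'n^'n \<Rightarrow> real^'n \<Rightarrow> (real^'n) set \<Rightarrow> (real^'n) set \<Rightarrow> real^'n \<Rightarrow> real^'n \<Rightarrow> bool" where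
  "regular_KKT_point H h E Z z l \<longleftrightarrow>
     (\<exists>\<nu>\<in>regular_normal_cone E z. 0 = (H *v z + h) + \<nu> - l) \<and>
     (\<exists>\<mu>\<in>regular_normal_cone Z z. 0 = \<mu> + l)"

definition R_matrix :: "real^'n^'n \<Rightarrow> real^'p^'n \<Rightarrow> real^'n^'n" where
  "R_matrix H V = V ** matrix_inv (transpose V ** H ** V) ** transpose V"

definition eigenvalues :: "real^'n^'n \<Rightarrow> real set" where
  "eigenvalues B = {e. \<exists>x. x \<noteq> 0 \<and> B *v x = e *\<^sub>R x}"

definition min_nonzero_eigenvalue :: "real^'n^'n \<Rightarrow> real" where
  "min_nonzero_eigenvalue B = Min (eigenvalues B - {0})"

definition M_matrix :: "real^'n^'n \<Rightarrow> real^'p^'n \<Rightarrow> real \<Rightarrow> real^'n^'n" where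
  "M_matrix H V \<xi> = \<xi> *\<^sub>R (matrix_inv (\<xi> *\<^sub>R R_matrix H V - mat 1) ** R_matrix H V)"

definition c_vector ::
  "real^'n^'n \<Rightarrow> real^'n \<Rightarrow> real^'p^'n \<Rightarrow> real^'n \<Rightarrow> real \<Rightarrow> real^'n" where
  "c_vector H h V v0 \<xi> =
     matrix_inv (\<xi> *\<^sub>R R_matrix H V - mat 1) *v (R_matrix H V *v (h + H *v v0) - v0)"

text \<open>
  The columns of \<open>Q\<close> with index in \<open>J\<close> play the role of the first \<open>r\<close> columns in
  \<open>M = Q diag(\<Lambda>,0) Q\<^sup>T\<close> with \<open>\<Lambda>\<close> of size \<open>r \<times> r\<close>; an arbitrary index type carries no order.
  Only the values of \<open>\<Lambda>\<close> on \<open>J\<close> matter.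
\<close>

definition spectral_form ::
  "nat \<Rightarrow> real^'n^'n \<Rightarrow> real^'n^'n \<Rightarrow> 'n set \<Rightarrow> ('n \<Rightarrow> real) \<Rightarrow> bool" where
  "spectral_form r M Q J \<Lambda> \<longleftrightarrow>
     orthogonal_matrix Q \<and> card J = r \<and> (\<forall>j\<in>J. \<Lambda> j > 0) \<and>
     M = Q ** diag_matrix (\<lambda>j. if j \<in> J then \<Lambda> j else 0) ** transpose Q"

definition W_matrix :: "real^'n^'n \<Rightarrow> 'n set \<Rightarrow> ('n \<Rightarrow> real) \<Rightarrow> real^'n^'n" where
  "W_matrix Q J \<Lambda> =
     Q ** diag_matrix (\<lambda>j. if j \<in> J then 1/2 * inverse (\<Lambda> j) else - 1) ** transpose Q"

definition T_operator ::
  "real^'n^'n \<Rightarrow> real^'n \<Rightarrow> real^'n^'n \<Rightarrow> (real^'n) set \<Rightarrow> real^'n \<Rightarrow> (real^'n) set" where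
  "T_operator M c W Z s = {s - W *v (M *v s + c - y) | y. y \<in> proj_set Z s}"

definition iteration_step ::
  "real^'n^'n \<Rightarrow> real^'n \<Rightarrow> real^'n^'n \<Rightarrow> (real^'n) set \<Rightarrow> real \<Rightarrow>
   (real^'n) \<times> (real^'n) \<times> (real^'n) \<Rightarrow> (real^'n) \<times> (real^'n) \<times> (real^'n) \<Rightarrow> bool" where
  "iteration_step M c W Z \<gamma> = (\<lambda>(z, y, s) (z', y', s').
     z' = M *v s + c \<and> y' \<in> proj_set Z s \<and> s' = s - \<gamma> *\<^sub>R (W *v (z' - y')))"

end

theory Submission
  imports Defs
begin

text \<open>
  Let \<open>(z, l)\<close> be a regular KKT point. The claim is that \<open>s = z - l / \<xi>\<close> is a fixed point with
  \<open>y = z\<close> as soon as \<open>\<xi>\<close> is large. Two facts have to be checked, namely \<open>M\<^sub>\<xi> s + c\<^sub>\<xi> = z\<close> and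
  \<open>z \<in> \<Pi>\<^sub>Z(s)\<close>; after that \<open>s - W (z - z) = s\<close> for any matrix \<open>W\<close>.

  The first fact is linear algebra. The normal cone of the affine set \<open>E\<close> is the orthogonal
  complement of the range of \<open>V\<close>, so stationarity reads \<open>V\<^sup>T (H z + h - l) = 0\<close>. Writing
  \<open>z = V v + v0\<close> and solving for \<open>v\<close> with the positive definite matrix \<open>V\<^sup>T H V\<close> gives
  \<open>z - v0 = R (l - h - H v0)\<close> (lemma \<open>KKT_imp_R_matrix_eq\<close>). This is the equation
  \<open>(\<xi> R - I) z = \<xi> R s + R (h + H v0) - v0\<close> in disguise, and \<open>\<xi> R - I\<close> is invertible once \<open>\<xi>\<close>
  exceeds the operator norm of \<open>H\<close> (lemma \<open>invertible_shifted_R_matrix\<close>).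

  The second fact is where the polyhedral structure enters. \<open>Z\<close> need not be convex, but each block of
  it is a finite union of closed convex sets. A closed set that misses \<open>z\<close> misses a neighbourhood
  of \<open>z\<close>, so near \<open>z\<close> only pieces containing \<open>z\<close> matter, and \<open>Z\<close> is star-shaped at \<open>z\<close> locally
  (lemma \<open>union_product_locally_starlike\<close>). Hence the first-order inequality that defines the regular
  normal cone holds without error term on a ball around \<open>z\<close>: \<open>- l \<bullet> (u - z) \<le> 0\<close> for
  \<open>u \<in> Z\<close> near \<open>z\<close>, and no such \<open>u\<close> is closer to \<open>s\<close> than \<open>z\<close>. Points of \<open>Z\<close> outside the ball are
  no competitors either, because \<open>s\<close> tends to \<open>z\<close> as \<open>\<xi>\<close> grows
  (lemma \<open>proj_set_of_regular_normal\<close>).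
\<close>

section \<open>Regular normals and projections onto locally star-shaped sets\<close>

text \<open>
  The difference quotient in the regular normal cone is constant along a ray from \<open>z\<close>, so its
  upper limit bounds its value at the far end of any segment that stays in \<open>C\<close>.
\<close>

lemma regular_normal_cone_segment:
  fixes z u x :: "'a::real_inner"
  assumes x: "x \<in> regular_normal_cone C z" and seg: "closed_segment z u \<subseteq> C"
  shows "x \<bullet> (u - z) \<le> 0"
proof (rule ccontr)
  assume "\<not> ?thesis"
  then have pos: "x \<bullet> (u - z) > 0" by simp
  then have "u \<noteq> z" by auto
  define q where "q = x \<bullet> (u - z) / norm (u - z)"
  have q: "q > 0" using pos \<open>u \<noteq> z\<close> by (simp add: q_def)
  have "Limsup (at z within C) (\<lambda>u. ereal ((x \<bullet> (u - z)) / norm (u - z))) < ereal q"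
    using x q by (auto simp: regular_normal_cone_def intro: le_less_trans)
  then have "\<forall>\<^sub>F y in at z within C. ereal ((x \<bullet> (y - z)) / norm (y - z)) < ereal q"
    by (rule Limsup_lessD)
  then obtain d where d: "d > 0"
    and small: "\<And>y. y \<in> C \<Longrightarrow> y \<noteq> z \<Longrightarrow> dist y z < d \<Longrightarrow> (x \<bullet> (y - z)) / norm (y - z) < q"
    by (auto simp: eventually_at)
  define t where "t = min 1 (d / (2 * norm (u - z)))"
  define y where "y = z + t *\<^sub>R (u - z)"
  have t: "0 < t" "t \<le> 1" using d \<open>u \<noteq> z\<close> by (auto simp: t_def)
  have "y = (1 - t) *\<^sub>R z + t *\<^sub>R u" by (simp add: y_def algebra_simps)
  then have "y \<in> closed_segment z u" using t unfolding in_segment by (intro exI[of _ t]) auto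
  then have "y \<in> C" using seg by blast
  moreover have "y \<noteq> z" using t \<open>u \<noteq> z\<close> by (simp add: y_def)
  moreover have "dist y z < d"
  proof -
    have "dist y z = t * norm (u - z)" using t by (simp add: y_def dist_norm)
    also have "\<dots> \<le> d / (2 * norm (u - z)) * norm (u - z)"
      by (intro mult_right_mono) (auto simp: t_def)
    also have "\<dots> = d / 2" using \<open>u \<noteq> z\<close> by simp
    finally show ?thesis using d by simp
  qed
  ultimately have "(x \<bullet> (y - z)) / norm (y - z) < q" by (rule small)
  moreover have "(x \<bullet> (y - z)) / norm (y - z) = q" using t by (simp add: y_def q_def)
  ultimately show False by simp
qed

text \<open>
  The segments from \<open>z\<close> in direction \<open>V w\<close> stay in the affine set for every \<open>w\<close>; the choice
  \<open>w = V\<^sup>T x\<close> turns the segment inequality into \<open>norm (V\<^sup>T x) ^ 2 \<le> 0\<close>.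
\<close>

lemma regular_normal_cone_affine_range:
  fixes V :: "real^'p^'n"
  assumes x: "x \<in> regular_normal_cone (range (\<lambda>v. V *v v + v0)) z"
  shows "transpose V *v x = 0"
proof -
  let ?E = "range (\<lambda>v. V *v v + v0)"
  obtain v where z: "z = V *v v + v0"
    using x by (auto simp: regular_normal_cone_def)
  have le: "x \<bullet> (V *v w) \<le> 0" for w
  proof -
    have "closed_segment z (z + V *v w) \<subseteq> ?E"
    proof
      fix y assume "y \<in> closed_segment z (z + V *v w)"
      then obtain t where "y = (1 - t) *\<^sub>R z + t *\<^sub>R (z + V *v w)"
        by (auto simp: in_segment)
      then have "y = V *v (v + t *\<^sub>R w) + v0"
        by (simp add: z algebra_simps matrix_vector_right_distrib matrix_vector_mult_scaleR)
      then show "y \<in> ?E" by blast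
    qed
    from regular_normal_cone_segment[OF x this] show ?thesis by simp
  qed
  let ?w = "transpose V *v x"
  have "?w \<bullet> ?w = x \<bullet> (V *v ?w)" by (simp add: dot_lmul_matrix)
  then show ?thesis using le[of ?w] by (metis inner_ge_zero inner_eq_zero_iff order_antisym)
qed

text \<open>
  With \<open>e = u - z\<close> the comparison \<open>norm (z + x / \<xi> - u) \<ge> norm (x / \<xi>)\<close> amounts to
  \<open>2 (x \<bullet> e) / \<xi> \<le> norm e ^ 2\<close>. Near \<open>z\<close> the left-hand side is nonpositive; at distance at least
  \<open>d\<close> from \<open>z\<close> Cauchy-Schwarz gives the inequality as soon as \<open>2 norm x / \<xi> \<le> d\<close>.
\<close>

lemma proj_set_of_regular_normal:
  fixes z x :: "'a::real_inner"
  assumes x: "x \<in> regular_normal_cone C z"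
    and star: "\<forall>\<^sub>F u in nhds z. u \<in> C \<longrightarrow> closed_segment z u \<subseteq> C"
  shows "\<exists>\<xi>0. \<forall>\<xi>\<ge>\<xi>0. z \<in> proj_set C (z + (1 / \<xi>) *\<^sub>R x)"
proof -
  obtain d where d: "d > 0"
    and near: "\<And>u. dist u z < d \<Longrightarrow> u \<in> C \<Longrightarrow> closed_segment z u \<subseteq> C"
    using star by (auto simp: eventually_nhds_metric)
  have "z \<in> proj_set C (z + (1 / \<xi>) *\<^sub>R x)" if \<xi>: "\<xi> \<ge> max 1 (2 * norm x / d)" for \<xi>
  proof -
    have \<xi>_pos: "\<xi> > 0" and far: "2 * norm x \<le> \<xi> * d"
      using \<xi> d by (auto simp: divide_le_eq)
    have closest: "norm ((1 / \<xi>) *\<^sub>R x) \<le> norm (z + (1 / \<xi>) *\<^sub>R x - u)" if "u \<in> C" for u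
    proof -
      define e where "e = u - z"
      have key: "2 * (x \<bullet> e) \<le> \<xi> * (e \<bullet> e)"
      proof (cases "dist u z < d")
        case True
        have "x \<bullet> e \<le> 0"
          unfolding e_def using regular_normal_cone_segment[OF x near[OF True that]] .
        moreover have "0 \<le> \<xi> * (e \<bullet> e)" using \<xi>_pos by simp
        ultimately show ?thesis by linarith
      next
        case False
        then have "d \<le> norm e" by (simp add: e_def dist_norm)
        have "2 * (x \<bullet> e) \<le> 2 * norm x * norm e" using norm_cauchy_schwarz[of x e] by simp
        also have "\<dots> \<le> (\<xi> * d) * norm e" using far by (rule mult_right_mono) simp
        also have "\<dots> \<le> (\<xi> * norm e) * norm e"
          using \<open>d \<le> norm e\<close> \<xi>_pos by (intro mult_right_mono mult_left_mono) auto
        finally show ?thesis by (simp add: dot_square_norm power2_eq_square)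
      qed
      have "z + (1 / \<xi>) *\<^sub>R x - u = (1 / \<xi>) *\<^sub>R x - e" by (simp add: e_def)
      moreover have "((1 / \<xi>) *\<^sub>R x - e) \<bullet> ((1 / \<xi>) *\<^sub>R x - e) =
          ((1 / \<xi>) *\<^sub>R x) \<bullet> ((1 / \<xi>) *\<^sub>R x) + (\<xi> * (e \<bullet> e) - 2 * (x \<bullet> e)) / \<xi>"
        using \<xi>_pos by (simp add: inner_diff_left inner_diff_right inner_commute field_simps)
      moreover have "(\<xi> * (e \<bullet> e) - 2 * (x \<bullet> e)) / \<xi> \<ge> 0" using key \<xi>_pos by simp
      ultimately show ?thesis unfolding norm_le by (simp only: le_add_same_cancel1)
    qed
    have "z \<in> C" using x by (simp add: regular_normal_cone_def)
    then show ?thesis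
      using closest by (auto simp: proj_set_def is_arg_min_def not_less)
  qed
  then show ?thesis by blast
qed

section \<open>Local structure of products of finite unions of convex sets\<close>

lemma linear_block_part: "linear (block_part blk k)"
  by (rule linearI) (auto simp: block_part_def vec_eq_iff)

text \<open>
  A piece \<open>P k i\<close> that contains the \<open>k\<close>-th block of a point \<open>u\<close> close to \<open>z\<close> also contains the
  \<open>k\<close>-th block of \<open>z\<close>, since the finitely many pieces that do not are closed and stay away from
  it. Convexity of the pieces then puts the whole segment into the product, block by block.
\<close>

lemma union_product_locally_starlike:
  assumes P: "\<And>k i. k \<in> {1..N} \<Longrightarrow> i \<in> {1..m k} \<Longrightarrow> closed (P k i) \<and> convex (P k i)"
  shows "\<forall>\<^sub>F u in nhds z. u \<in> union_product blk N m P \<longrightarrow>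
           closed_segment z u \<subseteq> union_product blk N m P"
proof -
  have "\<forall>\<^sub>F u in nhds z. block_part blk k u \<in> P k i \<longrightarrow> block_part blk k z \<in> P k i"
    if "k \<in> {1..N}" "i \<in> {1..m k}" for k i
  proof (cases "block_part blk k z \<in> P k i")
    case False
    have "open (block_part blk k -` (- P k i))"
      using P[OF that]
      by (intro open_vimage linear_continuous_on linear_block_part
          linear_conv_bounded_linear[THEN iffD1]) auto
    then have "\<forall>\<^sub>F u in nhds z. u \<in> block_part blk k -` (- P k i)"
      using False by (intro eventually_nhds_in_open) auto
    then show ?thesis by (rule eventually_mono) auto
  qed simp
  then have "\<forall>\<^sub>F u in nhds z. \<forall>k\<in>{1..N}. \<forall>i\<in>{1..m k}.
      block_part blk k u \<in> P k i \<longrightarrow> block_part blk k z \<in> P k i"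
    by (intro eventually_ball_finite ballI) auto
  then show ?thesis
  proof (rule eventually_mono, intro impI subsetI)
    fix u y
    assume active: "\<forall>k\<in>{1..N}. \<forall>i\<in>{1..m k}.
        block_part blk k u \<in> P k i \<longrightarrow> block_part blk k z \<in> P k i"
      and u: "u \<in> union_product blk N m P" and y: "y \<in> closed_segment z u"
    obtain t where t: "0 \<le> t" "t \<le> 1" "y = (1 - t) *\<^sub>R z + t *\<^sub>R u"
      using y by (auto simp: in_segment)
    have "block_part blk k y \<in> (\<Union>i\<in>{1..m k}. P k i)" if k: "k \<in> {1..N}" for k
    proof -
      obtain i where i: "i \<in> {1..m k}" "block_part blk k u \<in> P k i"
        using u k unfolding union_product_def by blast
      have "block_part blk k y =
          (1 - t) *\<^sub>R block_part blk k z + t *\<^sub>R block_part blk k u"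
        by (simp add: t(3) linear_add[OF linear_block_part] linear_scale[OF linear_block_part])
      also have "\<dots> \<in> P k i"
        using P[OF k i(1)] active k i t by (intro convexD) auto
      finally show ?thesis using i(1) by blast
    qed
    then show "y \<in> union_product blk N m P" by (simp add: union_product_def)
  qed
qed

section \<open>The matrix R\<close>

lemma inner_transpose_mult:
  fixes A :: "real^'p^'n"
  shows "v \<bullet> (transpose A *v x) = (A *v v) \<bullet> x"
  using dot_lmul_matrix[of x A v] by (simp add: inner_commute)

lemma
  fixes A :: "real^'n^'n"
  assumes "invertible A"
  shows matrix_inv_mult_left: "matrix_inv A *v (A *v x) = x"
    and matrix_inv_mult_right: "A *v (matrix_inv A *v x) = x"
proof -
  have "A ** matrix_inv A = mat 1 \<and> matrix_inv A ** A = mat 1"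
    using assms unfolding invertible_def matrix_inv_def by (rule someI_ex)
  then show "matrix_inv A *v (A *v x) = x" "A *v (matrix_inv A *v x) = x"
    by (simp_all add: matrix_vector_mul_assoc)
qed

lemma invertible_reduced_hessian:
  fixes H :: "real^'n^'n" and V :: "real^'p^'n"
  assumes H: "pos_def_matrix H" and V: "rank V = CARD('p)"
  shows "invertible (transpose V ** H ** V)"
proof -
  let ?K = "transpose V ** H ** V"
  have "v = 0" if "?K *v v = 0" for v
  proof (rule ccontr)
    assume "v \<noteq> 0"
    moreover have "inj ((*v) V)" using V by (simp add: full_rank_injective)
    ultimately have "V *v v \<noteq> 0" by (metis injD matrix_vector_mult_0_right)
    then have "(V *v v) \<bullet> (H *v (V *v v)) > 0" using H by (simp add: pos_def_matrix_def)
    also have "(V *v v) \<bullet> (H *v (V *v v)) = v \<bullet> (?K *v v)"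
      by (simp add: inner_transpose_mult del: transpose_matrix_vector
          flip: matrix_vector_mul_assoc)
    finally show False using that by simp
  qed
  then show ?thesis
    by (auto simp: invertible_left_inverse matrix_left_invertible_ker)
qed

lemma R_matrix_mult:
  "R_matrix H V *v x = V *v (matrix_inv (transpose V ** H ** V) *v (transpose V *v x))"
  by (simp add: R_matrix_def matrix_vector_mul_assoc matrix_mul_assoc
      del: transpose_matrix_vector)

text \<open>
  If \<open>\<xi> R x = x\<close> then \<open>x = V v\<close> with \<open>V\<^sup>T H V v = \<xi> V\<^sup>T x\<close>. Pairing with \<open>v\<close> gives
  \<open>x \<bullet> H x = \<xi> (x \<bullet> x)\<close>, which is impossible for \<open>x \<noteq> 0\<close> when \<open>\<xi>\<close> exceeds the operator norm
  of \<open>H\<close>. The same computation shows that every positive eigenvalue of \<open>R\<close> is at least the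
  reciprocal of this norm, so the bound is cruder than \<open>\<xi> > 1 / \<lambda>\<^sup>+\<^sub>m\<^sub>i\<^sub>n(R)\<close>, but it
  avoids the spectral theory of \<open>R\<close>.
\<close>

lemma invertible_shifted_R_matrix:
  fixes H :: "real^'n^'n" and V :: "real^'p^'n"
  assumes H: "pos_def_matrix H" and V: "rank V = CARD('p)"
    and \<xi>: "\<xi> > onorm ((*v) H)"
  shows "invertible (\<xi> *\<^sub>R R_matrix H V - mat 1)"
proof -
  let ?K = "transpose V ** H ** V"
  have "x = 0" if "(\<xi> *\<^sub>R R_matrix H V - mat 1) *v x = 0" for x
  proof (rule ccontr)
    assume "x \<noteq> 0"
    define v where "v = matrix_inv ?K *v (\<xi> *\<^sub>R (transpose V *v x))"
    have "x = \<xi> *\<^sub>R (R_matrix H V *v x)"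
      using that by (simp add: matrix_vector_mult_diff_rdistrib scaleR_matrix_vector_assoc)
    then have x: "x = V *v v"
      by (simp add: R_matrix_mult v_def matrix_vector_mult_scaleR)
    have Kv: "?K *v v = \<xi> *\<^sub>R (transpose V *v x)"
      unfolding v_def by (rule matrix_inv_mult_right[OF invertible_reduced_hessian[OF H V]])
    have "x \<bullet> (H *v x) = v \<bullet> (?K *v v)"
      by (simp add: x inner_transpose_mult del: transpose_matrix_vector
          flip: matrix_vector_mul_assoc)
    also have "\<dots> = \<xi> * (v \<bullet> (transpose V *v x))" by (simp add: Kv)
    also have "v \<bullet> (transpose V *v x) = x \<bullet> x"
      by (simp only: inner_transpose_mult flip: x)
    finally have eq: "x \<bullet> (H *v x) = \<xi> * (x \<bullet> x)" .
    have "x \<bullet> (H *v x) \<le> norm x * norm (H *v x)" by (rule norm_cauchy_schwarz)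
    also have "\<dots> \<le> norm x * (onorm ((*v) H) * norm x)"
      by (intro mult_left_mono onorm matrix_vector_mul_bounded_linear) simp
    also have "\<dots> = onorm ((*v) H) * (x \<bullet> x)" by (simp add: dot_square_norm power2_eq_square)
    also have "\<dots> < \<xi> * (x \<bullet> x)" using \<xi> \<open>x \<noteq> 0\<close> by (intro mult_strict_right_mono) auto
    finally show False using eq by simp
  qed
  then show ?thesis
    by (auto simp: invertible_left_inverse matrix_left_invertible_ker)
qed

text \<open>
  Stationarity says \<open>V\<^sup>T H V v = V\<^sup>T (l - h - H v0)\<close> for \<open>z = V v + v0\<close>; multiplying by
  \<open>V (V\<^sup>T H V)\<^sup>-\<^sup>1\<close> yields \<open>V v = z - v0\<close> on the left.
\<close>

lemma KKT_imp_R_matrix_eq: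
  fixes H :: "real^'n^'n" and V :: "real^'p^'n"
  assumes H: "pos_def_matrix H" and V: "rank V = CARD('p)"
    and z: "z = V *v v + v0" and stat: "transpose V *v (H *v z + h - l) = 0"
  shows "R_matrix H V *v (l - h - H *v v0) = z - v0"
proof -
  let ?K = "transpose V ** H ** V"
  have "?K *v v = transpose V *v (H *v z + h - l) + transpose V *v (l - h - H *v v0)"
    by (simp add: z matrix_vector_right_distrib matrix_vector_mult_diff_distrib
        flip: matrix_vector_mul_assoc)
  then have "?K *v v = transpose V *v (l - h - H *v v0)" by (simp only: stat add_0_left)
  then have "R_matrix H V *v (l - h - H *v v0) = V *v (matrix_inv ?K *v (?K *v v))"
    by (simp only: R_matrix_mult)
  also have "\<dots> = V *v v"
    by (simp add: matrix_inv_mult_left[OF invertible_reduced_hessian[OF H V]])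
  finally show ?thesis by (simp add: z)
qed

lemma M_matrix_c_vector_eq:
  fixes H :: "real^'n^'n" and V :: "real^'p^'n"
  assumes inv: "invertible (\<xi> *\<^sub>R R_matrix H V - mat 1)" and \<xi>: "\<xi> \<noteq> 0"
    and R: "R_matrix H V *v (l - h - H *v v0) = z - v0"
  shows "M_matrix H V \<xi> *v (z - (1 / \<xi>) *\<^sub>R l) + c_vector H h V v0 \<xi> = z"
proof -
  let ?R = "R_matrix H V" and ?B = "\<xi> *\<^sub>R R_matrix H V - mat 1"
  let ?s = "z - (1 / \<xi>) *\<^sub>R l"
  have "\<xi> *\<^sub>R (?R *v ?s) + (?R *v (h + H *v v0) - v0) =
      \<xi> *\<^sub>R (?R *v z) - ?R *v (l - h - H *v v0) - v0"
    using \<xi> by (simp add: matrix_vector_mult_diff_distrib matrix_vector_right_distrib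
        matrix_vector_mult_scaleR scaleR_diff_right)
  also have "\<dots> = ?B *v z"
    by (simp add: R matrix_vector_mult_diff_rdistrib scaleR_matrix_vector_assoc)
  finally have B: "\<xi> *\<^sub>R (?R *v ?s) + (?R *v (h + H *v v0) - v0) = ?B *v z" .
  have "M_matrix H V \<xi> *v ?s + c_vector H h V v0 \<xi> =
      matrix_inv ?B *v (\<xi> *\<^sub>R (?R *v ?s) + (?R *v (h + H *v v0) - v0))"
    by (simp add: M_matrix_def c_vector_def matrix_vector_right_distrib
        matrix_vector_mult_scaleR flip: scaleR_matrix_vector_assoc matrix_vector_mul_assoc)
  also have "\<dots> = z" unfolding B by (rule matrix_inv_mult_left[OF inv])
  finally show ?thesis .
qed

section \<open>Existence of fixed points\<close>

text \<open>
  At a point \<open>s\<close> with \<open>M s + c \<in> \<Pi>\<^sub>Z(s)\<close> the residual \<open>z - y\<close> can be chosen to vanish, so \<open>s\<close> is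
  fixed whatever the preconditioner and the step size are.
\<close>

lemma T_operator_fixed_pointI:
  assumes "M *v s + c \<in> proj_set Z s"
  shows "s \<in> T_operator M c W Z s"
  using assms by (auto simp: T_operator_def intro!: exI[of _ "M *v s + c"])

lemma iteration_step_fixed_pointI:
  assumes "M *v s + c \<in> proj_set Z s"
  shows "iteration_step M c W Z \<gamma> (M *v s + c, M *v s + c, s) (M *v s + c, M *v s + c, s)"
  using assms by (simp add: iteration_step_def)


theorem theorem4p3:
  fixes H :: "real^'n^'n" and h :: "real^'n"
    and A :: "real^'n^'m" and b :: "real^'m"
    and V :: "real^'p^'n" and v0 :: "real^'n"
    and blk :: "'n \<Rightarrow> nat" and N :: nat and m :: "nat \<Rightarrow> nat"
    and P :: "nat \<Rightarrow> nat \<Rightarrow> (real^'n) set"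
    and E Z :: "(real^'n) set"
  assumes H: "pos_def_matrix H"
    and blk: "\<And>j. blk j \<in> {1..N}"
    and P: "\<And>k i. k \<in> {1..N} \<Longrightarrow> i \<in> {1..m k} \<Longrightarrow>
              polyhedron (P k i) \<and> P k i \<subseteq> block_space blk k"
    and Z: "Z = union_product blk N m P"
    and E: "E = {z. A *v z = b}"
    and E_param: "E = range (\<lambda>v. V *v v + v0)"
    and dims: "CARD('n) = CARD('m) + CARD('p)"
    and rank_A: "rank A = CARD('m)"
    and rank_V: "rank V = CARD('p)"
    and feasible: "E \<inter> Z \<noteq> {}"
    and KKT: "\<exists>z l. regular_KKT_point H h E Z z l"
  shows "\<exists>\<xi>0 > 1 / min_nonzero_eigenvalue (R_matrix H V). \<forall>\<xi>\<ge>\<xi>0. \<forall>Q J \<Lambda>.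
           spectral_form CARD('p) (M_matrix H V \<xi>) Q J \<Lambda> \<longrightarrow>
             (\<exists>s. s \<in> T_operator (M_matrix H V \<xi>) (c_vector H h V v0 \<xi>) (W_matrix Q J \<Lambda>) Z s) \<and>
             (\<forall>\<gamma>. 0 < \<gamma> \<and> \<gamma> < 1 \<longrightarrow>
                (\<exists>z y s. iteration_step (M_matrix H V \<xi>) (c_vector H h V v0 \<xi>) (W_matrix Q J \<Lambda>) Z \<gamma>
                           (z, y, s) (z, y, s)))"
proof -
  obtain z l where KKT_zl: "regular_KKT_point H h E Z z l" using KKT by blast
  then obtain \<nu> \<mu> where \<nu>: "\<nu> \<in> regular_normal_cone E z" "0 = (H *v z + h) + \<nu> - l"
    and \<mu>: "\<mu> \<in> regular_normal_cone Z z" "0 = \<mu> + l"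
    unfolding regular_KKT_point_def by blast
  have \<nu>_eq: "H *v z + h - l = - \<nu>" using \<nu>(2) by (simp add: algebra_simps)
  have \<mu>_eq: "\<mu> = - l" using \<mu>(2) by (simp add: eq_neg_iff_add_eq_0)
  have "z \<in> E" using \<nu>(1) by (simp add: regular_normal_cone_def)
  then obtain v where z: "z = V *v v + v0" using E_param by blast
  have "transpose V *v \<nu> = 0"
    using \<nu>(1) unfolding E_param by (rule regular_normal_cone_affine_range)
  then have "transpose V *v (H *v z + h - l) = 0"
    unfolding \<nu>_eq using matrix_vector_mult_diff_distrib[of "transpose V" 0 \<nu>] by simp
  then have R: "R_matrix H V *v (l - h - H *v v0) = z - v0"
    by (rule KKT_imp_R_matrix_eq[OF H rank_V z])
  have "\<forall>\<^sub>F u in nhds z. u \<in> Z \<longrightarrow> closed_segment z u \<subseteq> Z"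
    unfolding Z using P
    by (intro union_product_locally_starlike) (auto simp: polyhedron_imp_closed polyhedron_imp_convex)
  then obtain \<xi>1 where \<xi>1: "\<And>\<xi>. \<xi> \<ge> \<xi>1 \<Longrightarrow> z \<in> proj_set Z (z + (1 / \<xi>) *\<^sub>R \<mu>)"
    using proj_set_of_regular_normal[OF \<mu>(1)] by blast
  \<comment> \<open>Beyond the second entry \<open>z\<close> is a projection of \<open>z - l / \<xi>\<close>; beyond the third \<open>\<xi> R - I\<close> is
    invertible.\<close>
  define \<xi>0 where "\<xi>0 = Max {1 / min_nonzero_eigenvalue (R_matrix H V) + 1, \<xi>1, onorm ((*v) H) + 1}"
  have bounds: "1 / min_nonzero_eigenvalue (R_matrix H V) < \<xi>0" "\<xi>1 \<le> \<xi>0" "onorm ((*v) H) < \<xi>0"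
    by (auto simp: \<xi>0_def less_max_iff_disj)
  have fixed: "\<exists>s. M_matrix H V \<xi> *v s + c_vector H h V v0 \<xi> \<in> proj_set Z s" if "\<xi> \<ge> \<xi>0" for \<xi>
  proof -
    have \<xi>: "\<xi> > onorm ((*v) H)" "\<xi> \<ge> \<xi>1" using bounds that by auto
    have "onorm ((*v) H) \<ge> 0" by (intro onorm_pos_le matrix_vector_mul_bounded_linear)
    then have "\<xi> \<noteq> 0" using \<xi>(1) by simp
    then have "M_matrix H V \<xi> *v (z - (1 / \<xi>) *\<^sub>R l) + c_vector H h V v0 \<xi> = z"
      by (intro M_matrix_c_vector_eq invertible_shifted_R_matrix[OF H rank_V \<xi>(1)] R)
    moreover have "z \<in> proj_set Z (z - (1 / \<xi>) *\<^sub>R l)" using \<xi>1[OF \<xi>(2)] by (simp add: \<mu>_eq)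
    ultimately show ?thesis by (intro exI[of _ "z - (1 / \<xi>) *\<^sub>R l"]) simp
  qed
  show ?thesis
  proof (intro exI[of _ \<xi>0] conjI allI impI)
    show "1 / min_nonzero_eigenvalue (R_matrix H V) < \<xi>0" by (fact bounds(1))
  next
    fix \<xi> Q J \<Lambda>
    assume "\<xi>0 \<le> \<xi>"
    then show "\<exists>s. s \<in> T_operator (M_matrix H V \<xi>) (c_vector H h V v0 \<xi>) (W_matrix Q J \<Lambda>) Z s"
      using fixed T_operator_fixed_pointI by blast
  next
    fix \<xi> \<gamma> :: real and Q J \<Lambda>
    assume "\<xi>0 \<le> \<xi>"
    then obtain s where "M_matrix H V \<xi> *v s + c_vector H h V v0 \<xi> \<in> proj_set Z s"
      using fixed by blast
    from iteration_step_fixed_pointI[OF this]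
    show "\<exists>z y s. iteration_step (M_matrix H V \<xi>) (c_vector H h V v0 \<xi>) (W_matrix Q J \<Lambda>) Z \<gamma>
        (z, y, s) (z, y, s)" by blast
  qed
qed

end
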